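(* Let $0\le\alpha<1$ and let $p(\cdot)\in\mathcal S$ with $p_+<\infty$, $p_-=1$, $1\le p_-\le p_+<\frac1\alpha$ (where $\frac1\alpha=\infty$ if $\alpha=0$) and $p(\cdot)\in LH_\infty(\mathbb Z)$. Define $q(\cdot)$ by $\frac1{p(k)}-\frac1{q(k)}=\alpha$ for all $k\in\mathbb Z$. Then there is a constant $C>0$, not depending on $a$, such that for every non-negative sequence $a=\{a(i)\}_{i\in\mathbb Z}\in\ell^{p(\cdot)}(\mathbb Z)$, $$\sup_{t>0}\; t\,\big\|\chi_{\{k\in\mathbb Z:\,M_\alpha a(k)>9t\}}\big\|_{\ell^{q(\cdot)}(\mathbb Z)}\le C\,\|a\|_{\ell^{p(\cdot)}(\mathbb Z)}.$$
   Context: $\mathcal S$ is the set of bounded sequences $p(\cdot)=\{p(n)\}_{n\in\mathbb Z}$ with values in $[1,\infty)$; $p_-=\inf_n p(n)$ and $p_+=\sup_n p(n)<\infty$. For $p(\cdot)\in\mathcal S$ the modular is $\rho_{p(\cdot)}(a)=\sum_{k\in\mathbb Z}|a(k)|^{p(k)}$; $\ell^{p(\cdot)}(\mathbb Z)$ is the set of real sequences $a$ on $\mathbb Z$ such that $\rho_{p(\cdot)}(a/\lambda)<\infty$ for some $\lambda>0$, with norm $\|a\|_{\ell^{p(\cdot)}(\mathbb Z)}=\inf\{\lambda>0:\rho_{p(\cdot)}(a/\lambda)\le1\}$. A sequence $p(\cdot)$ is log-Hölder continuous at infinity, written $p(\cdot)\in LH_\infty(\mathbb Z)$, if there are positive real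 constants $C_\infty,p_\infty$ such that $|p(n)-p_\infty|\le \frac{C_\infty}{\log(e+|n|)}$ for all $n\in\mathbb Z$. For $0\le\alpha<1$ the fractional Hardy–Littlewood maximal operator is $M_\alpha a(n)=\sup_{I\ni n}|I|^{\alpha-1}\sum_{k\in I}|a(k)|$, where the supremum is over all (finite) intervals $I$ of integers containing $n$ and $|I|$ is the cardinality of $I$. $\chi_E$ is the indicator sequence of $E\subset\mathbb Z$. *)

theory Defs
  imports "HOL-Analysis.Analysis"
begin

text \<open>
  The modular, the Luxemburg norm and the maximal operator take values in \<^typ>\<open>ennreal\<close>, so that
  divergent sums and unbounded suprema are \<^term>\<open>\<infinity>::ennreal\<close>, and a sequence outside the space
  (an empty infimum) has norm \<^term>\<open>\<infinity>::ennreal\<close>.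
\<close>

definition exponents :: "(int \<Rightarrow> real) set" where
  "exponents = {p. (\<forall>n. 1 \<le> p n) \<and> bdd_above (range p)}"

definition exp_inf :: "(int \<Rightarrow> real) \<Rightarrow> real" where
  "exp_inf p = (INF n. p n)"

definition exp_sup :: "(int \<Rightarrow> real) \<Rightarrow> real" where
  "exp_sup p = (SUP n. p n)"

definition log_Hoelder_infinity :: "(int \<Rightarrow> real) \<Rightarrow> bool" where
  "log_Hoelder_infinity p \<longleftrightarrow>
     (\<exists>C>0. \<exists>pinf>0. \<forall>n. \<bar>p n - pinf\<bar> \<le> C / ln (exp 1 + real_of_int \<bar>n\<bar>))"

definition modular :: "(int \<Rightarrow> real) \<Rightarrow> (int \<Rightarrow> real) \<Rightarrow> ennreal" where
  "modular p a = (\<Sum>\<^sub>\<infinity>k. ennreal (\<bar>a k\<bar> powr p k))"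

definition lpvar :: "(int \<Rightarrow> real) \<Rightarrow> (int \<Rightarrow> real) set" where
  "lpvar p = {a. \<exists>l>0. modular p (\<lambda>k. a k / l) < \<infinity>}"

definition lpvar_norm :: "(int \<Rightarrow> real) \<Rightarrow> (int \<Rightarrow> real) \<Rightarrow> ennreal" where
  "lpvar_norm p a = (INF l\<in>{l. 0 < l \<and> modular p (\<lambda>k. a k / l) \<le> 1}. ennreal l)"

definition frac_maximal :: "real \<Rightarrow> (int \<Rightarrow> real) \<Rightarrow> int \<Rightarrow> ennreal" where
  "frac_maximal \<alpha> a n =
     (SUP I\<in>{I. n \<in> I \<and> (\<exists>i j. I = {i..j})}.
        ennreal (real (card I) powr (\<alpha> - 1) * (\<Sum>k\<in>I. \<bar>a k\<bar>)))"

end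

theory Submission
  imports Defs "HOL-Real_Asymp.Real_Asymp"
begin

text \<open>
  On the integers, log-Hoelder continuity at infinity makes the variable exponent \<open>p\<close> and its limit
  \<open>P\<close> interchangeable: for \<open>0 \<le> u \<le> 1\<close> either \<open>u powr p k\<close> is below the summable weight
  \<open>(e + \<bar>k\<bar>)\<^sup>-\<^sup>2\<close>, or replacing \<open>p k\<close> by \<open>P\<close> costs only a bounded factor. A sequence of modular at
  most 1 is bounded by 1, so it lies in the \<open>P\<close>-summable sequences with a uniform bound. The weak-type
  estimate for the constant exponents \<open>P\<close> and \<open>Q = P / (1 - \<alpha> P)\<close> follows from Jensen's inequality
  on each interval and a Vitali covering argument; it forces the level \<open>t\<close> to be bounded as soon as
  the level set is nonempty, so the same exchange leads back from \<open>Q\<close> to \<open>q\<close>.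
\<close>

section \<open>Exchange of exponents against a summable weight\<close>

text \<open>The delicate case is \<open>r < s\<close> with \<open>u powr r\<close> above the weight
  \<open>x powr - 2\<close>. There \<open>1 \<le> r\<close> forces
  \<open>- ln u \<le> 2 * ln x\<close>, and the logarithm cancels the one in the bound for
  \<open>s - r\<close>, so \<open>u powr (r - s)\<close> is at most
  \<open>exp (2 * c)\<close>.\<close>

lemma powr_exponent_change:
  fixes u r s c x :: real
  assumes u: "0 \<le> u" "u \<le> 1" and r: "1 \<le> r" and c: "0 \<le> c" and x: "1 < x"
    and rs: "\<bar>r - s\<bar> \<le> c / ln x"
  shows "u powr r \<le> exp (2 * c) * u powr s + x powr - 2"
proof (cases "u = 0 \<or> s \<le> r \<or> u powr r \<le> x powr - 2")
  case True
  have "u powr r \<le> exp (2 * c) * u powr s" if "s \<le> r"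
  proof -
    have "u powr r \<le> 1 * u powr s" using powr_mono'[OF that u] by simp
    also have "\<dots> \<le> exp (2 * c) * u powr s" using c by (intro mult_right_mono) auto
    finally show ?thesis .
  qed
  moreover have "0 \<le> exp (2 * c) * u powr s" "0 \<le> x powr - 2" by auto
  ultimately show ?thesis using True by (auto intro: add_increasing add_increasing2)
next
  case False
  then have u0: "0 < u" and sr: "r < s" and big: "x powr - 2 < u powr r" using u by auto
  have lx: "0 < ln x" using x by simp
  have "- 2 * ln x < r * ln u" using big x u0 by (simp add: powr_def)
  moreover have "r * ln u \<le> 1 * ln u" using u u0 r by (intro mult_right_mono_neg) auto
  ultimately have lu: "- ln u \<le> 2 * ln x" by simp
  have "(s - r) * (- ln u) \<le> (c / ln x) * (2 * ln x)"
    using rs sr lu lx c u u0 by (intro mult_mono) auto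
  also have "\<dots> = 2 * c" using lx by simp
  finally have *: "(s - r) * (- ln u) \<le> 2 * c" .
  have "u powr r = exp ((s - r) * (- ln u)) * u powr s"
    using u0 by (simp add: powr_def algebra_simps flip: exp_add)
  also have "\<dots> \<le> exp (2 * c) * u powr s" using * by (intro mult_right_mono) auto
  finally show ?thesis by (simp add: add_increasing2)
qed

text \<open>Telescoping: each new term is at most the drop in \<open>1 / (real N + 1)\<close>. The
  subtracted term makes the induction close.\<close>

lemma sum_inverse_squares_le_2:
  "(\<Sum>n\<le>N. 1 / (real n + 1)\<^sup>2) \<le> 2 - 1 / (real N + 1)"
proof (induction N)
  case (Suc N)
  have "1 / (real N + 2)\<^sup>2 \<le> 1 / (real N + 1) - 1 / (real N + 2)"
  proof -
    have "1 / (real N + 2)\<^sup>2 \<le> 1 / ((real N + 1) * (real N + 2))"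
      unfolding power2_eq_square by (intro divide_left_mono mult_right_mono) auto
    then show ?thesis by (simp add: field_simps)
  qed
  then show ?case using Suc by (simp add: add.commute)
qed simp

text \<open>Since \<open>exp 1 \<ge> 2 \<ge> 1\<close>, the weight is dominated by the inverse
  squares, and each of the half-lines \<open>k \<ge> 0\<close> and \<open>k \<le> 0\<close>
  contributes at most 2. Counting 0 in both does no harm.\<close>

lemma sum_weight_le_4:
  fixes F :: "int set"
  assumes "finite F"
  shows "(\<Sum>k\<in>F. (exp 1 + real_of_int \<bar>k\<bar>) powr - 2) \<le> 4"
proof -
  define w where "w = (\<lambda>k::int. (exp 1 + real_of_int \<bar>k\<bar>) powr - 2)"
  define N where "N = Max (insert 0 ((\<lambda>k. nat \<bar>k\<bar>) ` F))"
  have w: "w (int n) \<le> 1 / (real n + 1)\<^sup>2" "w (- int n) = w (int n)" for n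
  proof -
    have "w (int n) \<le> (1 + real n) powr - 2"
      unfolding w_def using exp_ge_add_one_self[of "1::real"] by (intro powr_mono2') auto
    also have "\<dots> = 1 / (real n + 1)\<^sup>2"
      by (simp add: powr_minus powr_numeral field_simps)
    finally show "w (int n) \<le> 1 / (real n + 1)\<^sup>2" .
  qed (simp add: w_def)
  have half: "(\<Sum>n\<le>N. w (int n)) \<le> 2"
  proof -
    have "(\<Sum>n\<le>N. w (int n)) \<le> (\<Sum>n\<le>N. 1 / (real n + 1)\<^sup>2)" by (intro sum_mono w)
    also have "\<dots> \<le> 2 - 1 / (real N + 1)" by (rule sum_inverse_squares_le_2)
    finally show ?thesis by (rule order_trans) simp
  qed
  have "F \<subseteq> int ` {..N} \<union> (\<lambda>n. - int n) ` {..N}"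
  proof
    fix k assume "k \<in> F"
    then have "nat \<bar>k\<bar> \<le> N" unfolding N_def using assms by (intro Max_ge) auto
    moreover have "k = int (nat \<bar>k\<bar>) \<or> k = - int (nat \<bar>k\<bar>)" by auto
    ultimately show "k \<in> int ` {..N} \<union> (\<lambda>n. - int n) ` {..N}" by blast
  qed
  then have "sum w F \<le> sum w (int ` {..N} \<union> (\<lambda>n. - int n) ` {..N})"
    by (intro sum_mono2) (auto simp: w_def)
  also have "\<dots> \<le> sum w (int ` {..N}) + sum w ((\<lambda>n. - int n) ` {..N})"
    by (subst sum.union_inter[symmetric]) (auto intro!: sum_nonneg simp: w_def)
  also have "\<dots> = (\<Sum>n\<le>N. w (int n)) + (\<Sum>n\<le>N. w (- int n))"
    by (subst (1 2) sum.reindex) (auto simp: inj_on_def)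
  also have "\<dots> \<le> 4" using half by (simp add: w)
  finally show ?thesis by (simp add: w_def)
qed

text \<open>The additive error 4 is the same for every \<open>F\<close>, so bounds uniform over
  finite sets survive the exchange.\<close>

lemma sum_powr_exponent_change:
  fixes u r s :: "int \<Rightarrow> real"
  assumes "finite F" and u: "\<And>k. k \<in> F \<Longrightarrow> 0 \<le> u k \<and> u k \<le> 1"
    and r: "\<And>k. k \<in> F \<Longrightarrow> 1 \<le> r k" and c: "0 \<le> c"
    and rs: "\<And>k. k \<in> F \<Longrightarrow> \<bar>r k - s k\<bar> \<le> c / ln (exp 1 + real_of_int \<bar>k\<bar>)"
  shows "(\<Sum>k\<in>F. u k powr r k) \<le> exp (2 * c) * (\<Sum>k\<in>F. u k powr s k) + 4"
proof -
  have "(\<Sum>k\<in>F. u k powr r k)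
      \<le> (\<Sum>k\<in>F. exp (2 * c) * u k powr s k + (exp 1 + real_of_int \<bar>k\<bar>) powr - 2)"
    using u r c rs exp_ge_add_one_self[of "1::real"]
    by (intro sum_mono powr_exponent_change) auto
  also have "\<dots> \<le> exp (2 * c) * (\<Sum>k\<in>F. u k powr s k) + 4"
    using sum_weight_le_4[OF assms(1)] by (simp add: sum.distrib sum_distrib_left)
  finally show ?thesis .
qed

section \<open>Jensen's inequality and fractional averages over one interval\<close>

lemma sum_powr_le:
  fixes f :: "'a \<Rightarrow> real"
  assumes "finite S" and f: "\<And>i. i \<in> S \<Longrightarrow> 0 \<le> f i" and p: "1 \<le> p"
  shows "(\<Sum>i\<in>S. f i) powr p \<le> real (card S) powr (p - 1) * (\<Sum>i\<in>S. f i powr p)"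
proof -
  \<comment> \<open>Only positive terms enter Jensen's inequality, with equal weights
    \<open>1 / n\<close>; passing from \<open>card T\<close> back to \<open>card S\<close> uses
    \<open>p - 1 \<ge> 0\<close>.\<close>
  define T where "T = {i\<in>S. 0 < f i}"
  have T: "finite T" "T \<subseteq> S" using assms by (auto simp: T_def)
  have sumT: "(\<Sum>i\<in>S. f i) = (\<Sum>i\<in>T. f i)" "(\<Sum>i\<in>S. f i powr p) = (\<Sum>i\<in>T. f i powr p)"
    using assms(1) f by (force intro!: sum.mono_neutral_right simp: T_def order.order_iff_strict)+
  show ?thesis
  proof (cases "T = {}")
    case False
    define n where "n = real (card T)"
    have n: "0 < n" using T False by (simp add: n_def card_gt_0_iff)
    have "(\<Sum>i\<in>T. (1 / n) *\<^sub>R f i) powr p \<le> (\<Sum>i\<in>T. (1 / n) * (f i powr p))"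
      using convex_on_sum[OF T(1) False powr_convex[OF p], of "\<lambda>_. 1 / n" f] n
      by (auto simp: T_def n_def)
    then have "((\<Sum>i\<in>T. f i) / n) powr p \<le> (\<Sum>i\<in>T. f i powr p) / n"
      by (simp flip: sum_distrib_left sum_divide_distrib)
    then have "(\<Sum>i\<in>T. f i) powr p \<le> n powr p / n * (\<Sum>i\<in>T. f i powr p)"
      using n by (simp add: powr_divide sum_nonneg T_def field_simps)
    also have "n powr p / n = n powr (p - 1)" using n by (simp add: powr_diff)
    also have "n powr (p - 1) * (\<Sum>i\<in>T. f i powr p)
        \<le> real (card S) powr (p - 1) * (\<Sum>i\<in>T. f i powr p)"
      using p T assms(1) by (intro mult_right_mono powr_mono2) (auto simp: n_def card_mono sum_nonneg)
    finally show ?thesis by (simp add: sumT)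
  qed (simp add: sumT)
qed

text \<open>Jensen turns the \<open>p\<close>-th power of the average into
  \<open>n powr (- (1 - \<alpha> * p)) * X\<close>. Raising to
  \<open>q / p = 1 / (1 - \<alpha> * p)\<close> makes the power of \<open>n\<close> exactly
  -1.\<close>

lemma fractional_average_bound:
  fixes b :: "'a \<Rightarrow> real" and \<alpha> p q K s :: real
  assumes I: "finite I" "I \<noteq> {}" and b: "\<And>i. i \<in> I \<Longrightarrow> 0 \<le> b i"
    and p: "1 \<le> p" "\<alpha> * p < 1" and \<alpha>: "0 \<le> \<alpha>" and q: "q = p / (1 - \<alpha> * p)"
    and K: "(\<Sum>i\<in>I. b i powr p) \<le> K" and s: "0 < s"
    and avg: "s \<le> real (card I) powr (\<alpha> - 1) * (\<Sum>i\<in>I. b i)"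
  shows "real (card I) * s powr q \<le> K powr (q / p - 1) * (\<Sum>i\<in>I. b i powr p)"
proof -
  define n where "n = real (card I)"
  define X where "X = (\<Sum>i\<in>I. b i powr p)"
  have n: "0 < n" using I by (simp add: n_def card_gt_0_iff)
  have X: "0 \<le> X" by (simp add: X_def sum_nonneg)
  have d: "0 < 1 - \<alpha> * p" using p by simp
  have qp: "q / p = 1 / (1 - \<alpha> * p)" using p by (simp add: q)
  have "0 \<le> \<alpha> * p" using \<alpha> p by simp
  then have qp1: "1 \<le> q / p" using d by (simp add: qp)
  have "s powr p \<le> (n powr (\<alpha> - 1) * (\<Sum>i\<in>I. b i)) powr p"
    using avg s p by (intro powr_mono2) (auto simp: n_def)
  also have "\<dots> = n powr ((\<alpha> - 1) * p) * (\<Sum>i\<in>I. b i) powr p"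
    using b by (simp add: powr_mult powr_powr sum_nonneg)
  also have "\<dots> \<le> n powr ((\<alpha> - 1) * p) * (n powr (p - 1) * X)"
    unfolding n_def X_def using I b p by (intro mult_left_mono sum_powr_le) auto
  also have "\<dots> = n powr (- (1 - \<alpha> * p)) * X"
    by (simp add: algebra_simps flip: powr_add mult.assoc)
  finally have "(s powr p) powr (q / p) \<le> (n powr (- (1 - \<alpha> * p)) * X) powr (q / p)"
    using qp1 by (intro powr_mono2) auto
  also have "\<dots> = n powr (- 1) * X powr (q / p)"
  proof -
    have "- (1 - \<alpha> * p) * (q / p) = - 1" using d by (simp only: qp) (simp add: field_simps)
    then show ?thesis using X by (simp only: powr_mult powr_powr powr_ge_zero)
  qed
  also have "(s powr p) powr (q / p) = s powr q" using p by (simp add: powr_powr)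
  finally have "n * s powr q \<le> n * (n powr (- 1) * X powr (q / p))"
    using n by (intro mult_left_mono) auto
  also have "\<dots> = X powr (q / p)" using n by (simp add: powr_minus)
  \<comment> \<open>One factor \<open>X\<close> is kept and only the excess power is replaced by
    \<open>K\<close>: the bound stays linear in the local sum and so adds up over disjoint
    intervals.\<close>
  also have "\<dots> = X powr (q / p - 1) * X"
    using X by (cases "X = 0") (auto simp: powr_diff)
  also have "\<dots> \<le> K powr (q / p - 1) * X"
    using X K qp1 by (intro mult_right_mono powr_mono2) (auto simp: X_def)
  finally show ?thesis by (simp add: n_def X_def)
qed

section \<open>Vitali covering and weak type for constant exponents\<close>

text \<open>Greedy selection: take a longest interval \<open>J\<close>, discard every interval
  meeting it, and recurse on the rest. The discarded ones lie in an enlargement of \<open>J\<close>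
  with three times its cardinality.\<close>

lemma int_interval_Vitali:
  fixes \<I> :: "int set set"
  assumes "finite \<I>" and "\<And>I. I \<in> \<I> \<Longrightarrow> \<exists>i j. I = {i..j}"
  shows "\<exists>\<D>\<subseteq>\<I>. disjoint \<D> \<and> card (\<Union>\<I>) \<le> 3 * (\<Sum>I\<in>\<D>. card I)"
  using assms
proof (induction \<I> rule: finite_psubset_induct)
  case (psubset \<I>)
  have fin: "finite I" if "I \<in> \<I>" for I using psubset.prems[OF that] by auto
  show ?case
  proof (cases "\<Union>\<I> = {}")
    case True
    show ?thesis unfolding True by (intro exI[of _ "{}"]) auto
  next
    case False
    then have ne: "\<I> \<noteq> {}" by auto
    define J where "J = arg_max_on card \<I>"
    have J: "J \<in> \<I>" "card I \<le> card J" if "I \<in> \<I>" for I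
    proof -
      have "Max (card ` \<I>) \<in> card ` \<I>" using psubset.hyps ne by (intro Max_in) auto
      then obtain M where M: "M \<in> \<I>" "card M = Max (card ` \<I>)" by auto
      have "\<exists>x. is_arg_max card (\<lambda>x. x \<in> \<I>) x"
        using M psubset.hyps by (intro exI[of _ M]) (auto simp: is_arg_max_linorder)
      then have "is_arg_max card (\<lambda>x. x \<in> \<I>) J"
        unfolding J_def arg_max_on_def arg_max_def by (rule someI_ex)
      then show "J \<in> \<I>" "card I \<le> card J" using that by (auto simp: is_arg_max_linorder)
    qed
    have JI: "J \<in> \<I>" using ne J by blast
    \<comment> \<open>A nonempty \<open>J\<close> meets itself, so the family left for the induction
      is strictly smaller and cannot select \<open>J\<close> again.\<close>
    have Jne: "J \<noteq> {}"
    proof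
      assume "J = {}"
      then have "card I = 0" if "I \<in> \<I>" for I using J(2)[OF that] by simp
      then have "I = {}" if "I \<in> \<I>" for I using that fin by auto
      then show False using False by auto
    qed
    obtain i j where ij: "J = {i..j}" using psubset.prems[OF JI] by auto
    with Jne have le: "i \<le> j" by simp
    define \<I>' where "\<I>' = {I \<in> \<I>. I \<inter> J = {}}"
    have "\<I>' \<subset> \<I>" using JI Jne by (auto simp: \<I>'_def)
    then obtain \<D> where D: "\<D> \<subseteq> \<I>'" "disjoint \<D>" "card (\<Union>\<I>') \<le> 3 * (\<Sum>I\<in>\<D>. card I)"
      using psubset.IH[of \<I>'] psubset.prems by blast
    \<comment> \<open>An interval no longer than \<open>J\<close> that meets \<open>J\<close> sticks
      out by fewer than \<open>card J\<close> points on either side; this margin gives exactly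
      \<open>3 * card J\<close> points.\<close>
    define W where "W = {i - int (card J)..j + int (card J)}"
    have cJ: "int (card J) = j - i + 1" using ij le by simp
    have "\<Union>\<I> \<subseteq> W \<union> \<Union>\<I>'"
    proof
      fix x assume "x \<in> \<Union>\<I>"
      then obtain I where I: "I \<in> \<I>" "x \<in> I" by auto
      show "x \<in> W \<union> \<Union>\<I>'"
      proof (cases "I \<inter> J = {}")
        case False
        then obtain y where y: "y \<in> I" "y \<in> J" by auto
        obtain k l where kl: "I = {k..l}" using psubset.prems[OF I(1)] by auto
        have "int (card I) \<le> int (card J)" using J(2)[OF I(1)] by simp
        then have "x \<in> W" using kl y I ij cJ by (auto simp: W_def)
        then show ?thesis ..
      qed (use I in \<open>auto simp: \<I>'_def\<close>)
    qed
    moreover have "finite (W \<union> \<Union>\<I>')"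
      using psubset.hyps fin by (auto simp: W_def \<I>'_def)
    ultimately have "card (\<Union>\<I>) \<le> card (W \<union> \<Union>\<I>')" by (simp add: card_mono)
    also have "\<dots> \<le> card W + card (\<Union>\<I>')" by (rule card_Un_le)
    also have "card W = 3 * card J" using cJ le by (simp add: W_def)
    finally have "card (\<Union>\<I>) \<le> 3 * (card J + (\<Sum>I\<in>\<D>. card I))" using D(3) by simp
    moreover have "J \<notin> \<D>" "finite \<D>"
      using D(1) Jne psubset.hyps by (auto simp: \<I>'_def intro: finite_subset)
    moreover have "disjoint (insert J \<D>)"
      using D(1,2) by (auto simp: \<I>'_def pairwise_insert disjnt_def)
    moreover have "insert J \<D> \<subseteq> \<I>" using D(1) JI by (auto simp: \<I>'_def)
    ultimately show ?thesis by (intro exI[of _ "insert J \<D>"]) simp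
  qed
qed

text \<open>One interval is chosen for each point of \<open>F\<close>; the disjoint Vitali subfamily
  costs the factor 3. The local bounds then add up to a single sum over \<open>\<Union>\<D>\<close>,
  which is at most \<open>K\<close>.\<close>

lemma fractional_maximal_weak_type:
  fixes b :: "int \<Rightarrow> real" and \<alpha> p q K s :: real
  assumes b: "\<And>i. 0 \<le> b i" and p: "1 \<le> p" "\<alpha> * p < 1" and \<alpha>: "0 \<le> \<alpha>"
    and q: "q = p / (1 - \<alpha> * p)" and s: "0 < s"
    and K: "\<And>F. finite F \<Longrightarrow> (\<Sum>i\<in>F. b i powr p) \<le> K"
    and F: "finite F"
    and cov: "\<And>n. n \<in> F \<Longrightarrow> \<exists>i j. n \<in> {i..j} \<and>
       s \<le> real (card {i..j}) powr (\<alpha> - 1) * (\<Sum>k\<in>{i..j}. b k)"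
  shows "real (card F) * s powr q \<le> 3 * K powr (q / p)"
proof -
  have "\<exists>I. n \<in> F \<longrightarrow> n \<in> I \<and> (\<exists>i j. I = {i..j}) \<and>
       s \<le> real (card I) powr (\<alpha> - 1) * (\<Sum>k\<in>I. b k)" for n
    using cov[of n] by blast
  then obtain I where I: "\<And>n. n \<in> F \<Longrightarrow> n \<in> I n \<and> (\<exists>i j. I n = {i..j}) \<and>
       s \<le> real (card (I n)) powr (\<alpha> - 1) * (\<Sum>k\<in>I n. b k)" by metis
  have "\<exists>\<D>\<subseteq>I ` F. disjoint \<D> \<and> card (\<Union>(I ` F)) \<le> 3 * (\<Sum>I\<in>\<D>. card I)"
    using F I by (intro int_interval_Vitali) auto
  then obtain \<D> where D: "\<D> \<subseteq> I ` F" "disjoint \<D>" "card (\<Union>(I ` F)) \<le> 3 * (\<Sum>I\<in>\<D>. card I)"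
    by blast
  have finI: "finite (I n)" if "n \<in> F" for n using I[OF that] by (metis finite_atLeastAtMost_int)
  have finD: "finite J" if "J \<in> \<D>" for J using that D(1) finI by auto
  have K0: "0 \<le> K" using K[of "{}"] by simp
  have "card F \<le> card (\<Union>(I ` F))" using F finI I by (intro card_mono) auto
  with D(3) have "real (card F) \<le> real (3 * (\<Sum>J\<in>\<D>. card J))" by linarith
  then have "real (card F) * s powr q \<le> real (3 * (\<Sum>J\<in>\<D>. card J)) * s powr q"
    by (rule mult_right_mono) simp
  also have "\<dots> = 3 * (\<Sum>J\<in>\<D>. real (card J) * s powr q)" by (simp add: sum_distrib_right)
  also have "\<dots> \<le> 3 * (\<Sum>J\<in>\<D>. K powr (q / p - 1) * (\<Sum>i\<in>J. b i powr p))"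
  proof (intro mult_left_mono sum_mono)
    fix J assume J: "J \<in> \<D>"
    then obtain n where n: "n \<in> F" "J = I n" using D(1) by auto
    show "real (card J) * s powr q \<le> K powr (q / p - 1) * (\<Sum>i\<in>J. b i powr p)"
      using I[OF n(1)] finD[OF J] unfolding n(2)[symmetric]
      by (intro fractional_average_bound[OF _ _ b p \<alpha> q K s]) auto
  qed simp
  also have "\<dots> = 3 * K powr (q / p - 1) * (\<Sum>J\<in>\<D>. \<Sum>i\<in>J. b i powr p)"
    by (simp add: sum_distrib_left mult.assoc)
  also have "(\<Sum>J\<in>\<D>. \<Sum>i\<in>J. b i powr p) = (\<Sum>i\<in>\<Union>\<D>. b i powr p)"
    using D(2) finD by (subst sum.Union_disjoint) (auto simp: pairwise_def disjnt_def)
  also have "3 * K powr (q / p - 1) * (\<Sum>i\<in>\<Union>\<D>. b i powr p) \<le> 3 * K powr (q / p - 1) * K"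
    using finite_subset[OF D(1)] F finD by (intro mult_left_mono K) auto
  also have "\<dots> = 3 * K powr (q / p)" using K0 by (cases "K = 0") (auto simp: powr_diff)
  finally show ?thesis .
qed

section \<open>Modular and Luxemburg norm\<close>

text \<open>An infinite sum in \<open>ennreal\<close> is the supremum of its finite partial sums, so
  the estimates can be made on finite real sums.\<close>

lemma modular_le_1_iff:
  "modular p a \<le> 1 \<longleftrightarrow> (\<forall>F. finite F \<longrightarrow> (\<Sum>k\<in>F. \<bar>a k\<bar> powr p k) \<le> 1)"
proof -
  have "modular p a = (SUP F\<in>{F. finite F \<and> F \<subseteq> UNIV}. \<Sum>k\<in>F. ennreal (\<bar>a k\<bar> powr p k))"
    unfolding modular_def by (rule nonneg_infsum_complete) simp
  then show ?thesis by (auto simp: SUP_le_iff)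
qed

text \<open>Reduces an estimate by the norm to one admissible \<open>l\<close> at a time. Dividing
  by \<open>C\<close> first exposes the bare infimum, whose empty case is covered too.\<close>

lemma le_mult_lpvar_norm:
  fixes C :: real
  assumes C: "0 < C"
    and le: "\<And>l. 0 < l \<Longrightarrow> modular p (\<lambda>k. a k / l) \<le> 1 \<Longrightarrow> Y \<le> ennreal (C * l)"
  shows "Y \<le> ennreal C * lpvar_norm p a"
proof -
  have "ennreal (1 / C) * Y \<le> lpvar_norm p a"
    unfolding lpvar_norm_def
  proof (rule INF_greatest)
    fix l assume "l \<in> {l. 0 < l \<and> modular p (\<lambda>k. a k / l) \<le> 1}"
    then have "ennreal (1 / C) * Y \<le> ennreal (1 / C) * ennreal (C * l)"
      using le by (intro mult_left_mono) auto
    also have "\<dots> = ennreal l" using C by (simp flip: ennreal_mult')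
    finally show "ennreal (1 / C) * Y \<le> ennreal l" .
  qed
  then have "ennreal C * (ennreal (1 / C) * Y) \<le> ennreal C * lpvar_norm p a"
    by (rule mult_left_mono) simp
  moreover have "ennreal C * (ennreal (1 / C) * Y) = Y"
    using C by (simp flip: mult.assoc ennreal_mult')
  ultimately show ?thesis by simp
qed

lemma lpvar_norm_le:
  assumes "0 < l" and "modular p (\<lambda>k. a k / l) \<le> 1"
  shows "lpvar_norm p a \<le> ennreal l"
  unfolding lpvar_norm_def using assms by (intro INF_lower) auto

section \<open>Limit exponent and the estimate for variable exponents\<close>

text \<open>The bound in \<open>c\<close> tends to 0, so \<open>P\<close> is the limit of
  \<open>p n\<close> as \<open>n\<close> tends to infinity and inherits the lower bound.\<close>

lemma log_Hoelder_limit_ge_1: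
  assumes p: "\<And>n. 1 \<le> p n"
    and c: "\<And>n::int. \<bar>p n - P\<bar> \<le> c / ln (exp 1 + real_of_int \<bar>n\<bar>)"
  shows "1 \<le> P"
proof -
  have "((\<lambda>n. c / ln (exp 1 + real n)) \<longlongrightarrow> 0) sequentially" by real_asymp
  moreover have "\<forall>\<^sub>F n in sequentially. 1 - P \<le> c / ln (exp 1 + real n)"
    using p c by (intro always_eventually allI) (smt (verit, best) of_int_of_nat_eq of_nat_0_le_iff)
  ultimately have "1 - P \<le> 0" by (rule tendsto_lowerbound) simp
  then show ?thesis by simp
qed

theorem theorem5p2:
  fixes \<alpha> :: real and p q :: "int \<Rightarrow> real"
  assumes "0 \<le> \<alpha>" and "\<alpha> < 1"
    and "p \<in> exponents"
    and "exp_inf p = 1"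
    and "\<alpha> > 0 \<Longrightarrow> exp_sup p < 1 / \<alpha>"
    and "log_Hoelder_infinity p"
    and "\<And>k. 1 / p k - 1 / q k = \<alpha>"
  shows "\<exists>C::real. C > 0 \<and> (\<forall>a::int \<Rightarrow> real. (\<forall>i. 0 \<le> a i) \<longrightarrow> a \<in> lpvar p \<longrightarrow>
           (SUP t\<in>{0::real<..}.
              ennreal t * lpvar_norm q (indicator {k. frac_maximal \<alpha> a k > ennreal (9 * t)}))
           \<le> ennreal C * lpvar_norm p a)"
proof -
  have p1: "1 \<le> p k" and bdd: "bdd_above (range p)" for k
    using assms(3) by (auto simp: exponents_def)
  obtain c P where c: "0 < c"
    and LH: "\<And>n. \<bar>p n - P\<bar> \<le> c / ln (exp 1 + real_of_int \<bar>n\<bar>)"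
    using assms(6) by (auto simp: log_Hoelder_infinity_def)
  define m where "m = exp_sup p"
  have pm: "p k \<le> m" for k
    unfolding m_def exp_sup_def using bdd by (intro cSUP_upper) auto
  have P1: "1 \<le> P" using p1 LH by (rule log_Hoelder_limit_ge_1)
  \<comment> \<open>The upper bound comes from the lower one applied to the reflected sequence
    \<open>1 + m - p n\<close>, whose limit is \<open>1 + m - P\<close>.\<close>
  have Pm: "P \<le> m"
  proof -
    have "1 \<le> 1 + m - P"
    proof (rule log_Hoelder_limit_ge_1[where p = "\<lambda>n. 1 + m - p n"])
      show "1 \<le> 1 + m - p n" for n using pm[of n] by simp
      show "\<bar>1 + m - p n - (1 + m - P)\<bar> \<le> c / ln (exp 1 + real_of_int \<bar>n\<bar>)" for n
        using LH[of n] by linarith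
    qed
    then show ?thesis by simp
  qed
  \<comment> \<open>A common positive lower bound for the denominators
    \<open>1 - \<alpha> * p k\<close> and \<open>1 - \<alpha> * P\<close>.\<close>
  define d where "d = 1 - \<alpha> * m"
  have d: "0 < d"
    using assms(1,5) by (cases "\<alpha> = 0") (auto simp: d_def m_def field_simps)
  have dp: "d \<le> 1 - \<alpha> * p k" for k
    unfolding d_def using mult_left_mono[OF pm[of k] assms(1)] by simp
  have dP: "d \<le> 1 - \<alpha> * P"
    unfolding d_def using mult_left_mono[OF Pm assms(1)] by simp
  define Q where "Q = P / (1 - \<alpha> * P)"
  have q: "q k = p k / (1 - \<alpha> * p k)" for k
  proof -
    have "1 / q k = 1 / p k - \<alpha>" using assms(7)[of k] by simp
    also have "\<dots> = (1 - \<alpha> * p k) / p k" using p1[of k] by (simp add: field_simps)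
    finally show ?thesis by (metis inverse_divide inverse_eq_divide inverse_inverse_eq)
  qed
  have ge1: "1 \<le> x / (1 - \<alpha> * x)" if "1 \<le> x" "d \<le> 1 - \<alpha> * x" for x
  proof -
    have "1 - \<alpha> * x \<le> x" using that mult_nonneg_nonneg[OF assms(1), of x] by linarith
    then show ?thesis using that d by simp
  qed
  have q1: "1 \<le> q k" for k unfolding q by (rule ge1[OF p1 dp])
  have Q1: "1 \<le> Q" unfolding Q_def by (rule ge1[OF P1 dP])
  \<comment> \<open>The difference \<open>q k - Q\<close> is \<open>p k - P\<close> over the product
    of the two denominators, each at least \<open>d\<close>; so \<open>q\<close> inherits
    log-Hoelder continuity.\<close>
  define c' where "c' = c / (d * d)"
  have c': "0 < c'" using c d by (simp add: c'_def)
  have LHq: "\<bar>q k - Q\<bar> \<le> c' / ln (exp 1 + real_of_int \<bar>k\<bar>)" for k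
  proof -
    have pos: "0 < 1 - \<alpha> * p k" "0 < 1 - \<alpha> * P" using d dp[of k] dP by linarith+
    then have "q k - Q = (p k - P) / ((1 - \<alpha> * p k) * (1 - \<alpha> * P))"
      by (simp add: q Q_def field_simps)
    then have "\<bar>q k - Q\<bar> = \<bar>p k - P\<bar> / ((1 - \<alpha> * p k) * (1 - \<alpha> * P))"
      using pos by (simp add: abs_mult)
    also have "\<dots> \<le> \<bar>p k - P\<bar> / (d * d)"
      using d dp[of k] dP pos by (intro divide_left_mono mult_mono) auto
    also have "\<dots> \<le> (c / ln (exp 1 + real_of_int \<bar>k\<bar>)) / (d * d)"
      using LH[of k] d by (intro divide_right_mono) auto
    finally show ?thesis by (simp add: c'_def mult.commute)
  qed
  \<comment> \<open>\<open>K\<close> bounds the \<open>P\<close>-sums of a sequence of modular at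
    most 1, \<open>A\<close> is the resulting weak-type constant, and \<open>B\<close> is the cost
    of returning from \<open>Q\<close> to \<open>q\<close>.\<close>
  define K where "K = exp (2 * c) + 4"
  define A where "A = 3 * K powr (Q / P)"
  define B where "B = exp (2 * c') + 4"
  have "1 \<le> K" unfolding K_def by (simp add: add_increasing)
  moreover have "0 \<le> Q / P" using P1 Q1 by simp
  ultimately have A1: "1 \<le> A" unfolding A_def using ge_one_powr_ge_zero[of K "Q / P"] by linarith
  have B1: "1 \<le> B" unfolding B_def by (simp add: add_increasing)
  have main: "ennreal t * lpvar_norm q (indicator {k. frac_maximal \<alpha> a k > ennreal (9 * t)})
      \<le> ennreal (A * B / 9 * l)"
    if a: "\<And>i. 0 \<le> a i" and t: "0 < t" and l: "0 < l" and mod: "modular p (\<lambda>k. a k / l) \<le> 1"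
    for a t l
  proof -
    define E where "E = {k. frac_maximal \<alpha> a k > ennreal (9 * t)}"
    define b where "b = (\<lambda>k. a k / l)"
    \<comment> \<open>Dividing the sequence by \<open>l\<close> turns the level \<open>9 * t\<close>
      into \<open>s\<close>.\<close>
    define s where "s = 9 * t / l"
    have b: "0 \<le> b i" for i using a l by (simp add: b_def)
    have s: "0 < s" using t l by (simp add: s_def)
    have modp: "(\<Sum>k\<in>F. b k powr p k) \<le> 1" if "finite F" for F
      using mod that b by (auto simp: modular_le_1_iff simp flip: b_def)
    have b1: "b k \<le> 1" for k
    proof (rule ccontr)
      assume "\<not> b k \<le> 1"
      then have "1 < b k powr p k" using p1[of k] by (intro gr_one_powr) auto
      then show False using modp[of "{k}"] by simp
    qed
    have K: "(\<Sum>k\<in>F. b k powr P) \<le> K" if "finite F" for F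
    proof -
      have "(\<Sum>k\<in>F. b k powr P) \<le> exp (2 * c) * (\<Sum>k\<in>F. b k powr p k) + 4"
        using that b b1 P1 c LH by (intro sum_powr_exponent_change) (auto simp: abs_minus_commute)
      also have "\<dots> \<le> exp (2 * c) * 1 + 4"
        using modp[OF that] by (intro add_right_mono mult_left_mono) auto
      finally show ?thesis by (simp add: K_def)
    qed
    have cov: "\<exists>i j. n \<in> {i..j} \<and>
       s \<le> real (card {i..j}) powr (\<alpha> - 1) * (\<Sum>k\<in>{i..j}. b k)" if n: "n \<in> E" for n
    proof -
      from n obtain i j where ij: "n \<in> {i..j}"
        "ennreal (9 * t) < ennreal (real (card {i..j}) powr (\<alpha> - 1) * (\<Sum>k\<in>{i..j}. \<bar>a k\<bar>))"
        unfolding E_def frac_maximal_def by (auto simp: less_SUP_iff)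
      then have "9 * t < real (card {i..j}) powr (\<alpha> - 1) * (\<Sum>k\<in>{i..j}. a k)"
        using a t by (simp add: ennreal_less_iff)
      then have "s \<le> (real (card {i..j}) powr (\<alpha> - 1) * (\<Sum>k\<in>{i..j}. a k)) / l"
        unfolding s_def using l by (intro divide_right_mono) auto
      also have "\<dots> = real (card {i..j}) powr (\<alpha> - 1) * (\<Sum>k\<in>{i..j}. b k)"
        by (simp add: b_def flip: sum_divide_distrib)
      finally show ?thesis using ij(1) by blast
    qed
    have weak: "real (card F) * s powr Q \<le> A" if "finite F" "F \<subseteq> E" for F
      unfolding A_def using d dP that cov
      by (intro fractional_maximal_weak_type[OF b P1 _ assms(1) Q_def s K]) auto
    \<comment> \<open>As \<open>A\<close> and \<open>Q\<close> are at least 1, dividing the level by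
      \<open>A\<close> absorbs the constant and leaves the bound 1 in \<open>uF\<close>.\<close>
    define u where "u = s / A"
    have u: "0 < u" using s A1 by (simp add: u_def)
    have uF: "real (card F) * u powr Q \<le> 1" if F: "finite F" "F \<subseteq> E" for F
    proof -
      have "A powr 1 \<le> A powr Q" using A1 Q1 by (intro powr_mono) auto
      then have "real (card F) * s powr Q \<le> 1 * A powr Q" using weak[OF F] A1 by simp
      then show ?thesis using s A1 by (simp add: u_def powr_divide field_simps)
    qed
    \<comment> \<open>A single point of \<open>E\<close> already bounds \<open>u powr Q\<close> by
      1; this makes the exchange from \<open>Q\<close> to \<open>q\<close> available.\<close>
    have u1: "u \<le> 1" if "E \<noteq> {}"
    proof (rule ccontr)
      assume "\<not> u \<le> 1"
      then have "1 < u powr Q" using Q1 by (intro gr_one_powr) auto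
      moreover obtain k where "k \<in> E" using \<open>E \<noteq> {}\<close> by auto
      ultimately show False using uF[of "{k}"] by simp
    qed
    have uq: "(\<Sum>k\<in>F. u powr q k) \<le> B" if F: "finite F" "F \<subseteq> E" for F
    proof (cases "F = {}")
      case False
      then have "u \<le> 1" using u1 F by auto
      then have "(\<Sum>k\<in>F. u powr q k) \<le> exp (2 * c') * (\<Sum>k\<in>F. u powr Q) + 4"
        using F u q1 c' LHq by (intro sum_powr_exponent_change) auto
      also have "\<dots> \<le> exp (2 * c') * 1 + 4"
        using uF[OF F] by (intro add_right_mono mult_left_mono) auto
      finally show ?thesis by (simp add: B_def)
    qed (use B1 in simp)
    \<comment> \<open>With \<open>B\<close> and \<open>q k\<close> at least 1, dividing
      \<open>u\<close> by \<open>B\<close> divides each \<open>u powr q k\<close> by at least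
      \<open>B\<close>, so the modular drops to at most 1.\<close>
    have "lpvar_norm q (indicator E) \<le> ennreal (B / u)"
    proof (rule lpvar_norm_le)
      show "0 < B / u" using B1 u by simp
      show "modular q (\<lambda>k. indicator E k / (B / u)) \<le> 1"
        unfolding modular_le_1_iff
      proof (intro allI impI)
        fix F :: "int set" assume F: "finite F"
        have "(\<Sum>k\<in>F. \<bar>indicator E k / (B / u)\<bar> powr q k) = (\<Sum>k\<in>F \<inter> E. (u / B) powr q k)"
          using F B1 u by (intro sum.mono_neutral_cong_right) (auto simp: indicator_def)
        also have "\<dots> \<le> (\<Sum>k\<in>F \<inter> E. u powr q k / B)"
        proof (rule sum_mono)
          fix k
          have "B powr 1 \<le> B powr q k" using B1 q1[of k] by (intro powr_mono) auto
          then show "(u / B) powr q k \<le> u powr q k / B"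
            using B1 u by (simp add: powr_divide divide_left_mono)
        qed
        also have "\<dots> = (\<Sum>k\<in>F \<inter> E. u powr q k) / B" by (simp add: sum_divide_distrib)
        also have "\<dots> \<le> 1" using uq[of "F \<inter> E"] F B1 by simp
        finally show "(\<Sum>k\<in>F. \<bar>indicator E k / (B / u)\<bar> powr q k) \<le> 1" .
      qed
    qed
    then have "ennreal t * lpvar_norm q (indicator E) \<le> ennreal t * ennreal (B / u)"
      by (rule mult_left_mono) simp
    also have "\<dots> = ennreal (t * (B / u))" using t by (intro ennreal_mult'[symmetric]) simp
    \<comment> \<open>Since \<open>u\<close> is proportional to \<open>t / l\<close>, the level
      cancels; hence the constant is uniform in \<open>t\<close>.\<close>
    also have "t * (B / u) = A * B / 9 * l"
      using t l A1 by (simp add: u_def s_def field_simps)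
    finally show ?thesis by (simp add: E_def)
  qed
  show ?thesis
  proof (intro exI[of _ "A * B / 9"] conjI allI impI)
    show C: "0 < A * B / 9" using A1 B1 by simp
    fix a :: "int \<Rightarrow> real" assume "\<forall>i. 0 \<le> a i"
    then show "(SUP t\<in>{0::real<..}.
              ennreal t * lpvar_norm q (indicator {k. frac_maximal \<alpha> a k > ennreal (9 * t)}))
           \<le> ennreal (A * B / 9) * lpvar_norm p a"
      by (intro SUP_least le_mult_lpvar_norm[OF C] main) auto
  qed
qed

end
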